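(* Let $\phi:[1,+\infty)\to\mathbb R_+$ be concave, increasing and twice differentiable with $\liminf_{t\to+\infty}\frac{t\phi''(t)}{\phi'(t)}>-2$. Then there exists a constant $C_\phi>0$ such that for every distribution $p$ of the running time $T\in[1,+\infty]$, \[ \mathcal{L}_p(S^{\mathrm{PRS}})\;\leq\;C_\phi\,\mu_\phi(T). \]
   Context: Restart setup: a Las Vegas algorithm has random running time $T\in[1,+\infty]$ with distribution $p$. Given a (possibly random) cutoff sequence $S\in[1,+\infty)^{\mathbb N}$, the multi-start algorithm runs the algorithm successively with cutoffs $S_0,S_1,\dots$; at round $k$ a fresh copy with running time $T_k$ is run for at most $S_k$, where $T_0,T_1,\dots$ are i.i.d. with distribution $p$ and independent of the randomness of $S$; it stops at $K^\star=\min\{k\geq0:T_k\leq S_k\}$, and $\mathcal{L}_p(S)=\mathbb{E}\big[\sum_{k=0}^{K^\star-1}S_k+T_{K^\star}\big]$. The random sequence $S^{\mathrm{PRS}}$ is defined as follows: initialize counters $K_i=0$ for $i\in\mathbb N$; for $k=0,1,\dots$: sample $I\in\mathbb N$ with probability proportional to $(1-2^{-i-2})^{K_i}/(1+i\log_2^2 i)$ (convention $0\cdot\log_2^2 0=0$), independently given the past, set $S^{\mathrm{PRS}}_k=(1-2^{-I-2})^{-K_I}$, and increase $K_I$ by one. For a positive, continuous, increasing $\phi$, $\mu_\phi(T)=\phi^{-1}(\mathbb{E}[\phi(T)])$, where $\phi(+\infty)=\lim_{t\to+\infty}\phi(t)$ and $\mu_\phi(T)=+\infty$ if $\mathbb{E}[\phi(T)]$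 is not attained by $\phi$ on $[1,+\infty)$. *)

theory Defs
  imports "HOL-Probability.Probability"
begin

section \<open>Cost of the multi-start algorithm\<close>

text \<open>
  The sequence \<open>t\<close> gives the running times of the successive fresh copies. If no round ever succeeds,
  the algorithm runs through all the cutoffs.
\<close>

definition multistart_time :: "(nat \<Rightarrow> real) \<Rightarrow> (nat \<Rightarrow> ennreal) \<Rightarrow> ennreal" where
  "multistart_time S t =
     (if \<exists>k. t k \<le> ennreal (S k)
      then let K = (LEAST k. t k \<le> ennreal (S k)) in (\<Sum>k<K. ennreal (S k)) + t K
      else (\<Sum>k. ennreal (S k)))"

text \<open>
  A random cutoff sequence is a function \<open>S\<close> on a probability space \<open>M\<close>. The product with \<open>M\<close> makes
  the running times, which are i.i.d. with distribution \<open>p\<close>, independent of \<open>S\<close>.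
\<close>

definition expected_cost :: "ennreal measure \<Rightarrow> 'w measure \<Rightarrow> ('w \<Rightarrow> nat \<Rightarrow> real) \<Rightarrow> ennreal" where
  "expected_cost p M S =
     (\<integral>\<^sup>+ x. multistart_time (S (fst x)) (snd x) \<partial>(M \<Otimes>\<^sub>M (\<Pi>\<^sub>M k\<in>(UNIV::nat set). p)))"

definition running_time_distribution :: "ennreal measure \<Rightarrow> bool" where
  "running_time_distribution p \<longleftrightarrow>
     prob_space p \<and> sets p = sets borel \<and> (AE t in p. 1 \<le> t)"


section \<open>Generalised means\<close>

definition extend_infinity :: "(real \<Rightarrow> real) \<Rightarrow> ennreal \<Rightarrow> ennreal" where
  "extend_infinity \<phi> t =
     (if t = \<infinity> then Lim at_top (\<lambda>s::real. ennreal (\<phi> s)) else ennreal (\<phi> (enn2real t)))"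

definition phi_mean :: "(real \<Rightarrow> real) \<Rightarrow> ennreal measure \<Rightarrow> ennreal" where
  "phi_mean \<phi> p =
     (let m = (\<integral>\<^sup>+ t. extend_infinity \<phi> t \<partial>p) in
      if m \<in> (\<lambda>t. ennreal (\<phi> t)) ` {1..}
      then ennreal (the_inv_into {1..} (\<lambda>t. ennreal (\<phi> t)) m)
      else \<infinity>)"


section \<open>The random sequence PRS\<close>

text \<open>
  The randomness of PRS is the sequence \<open>I\<close> of sampled indices: \<open>prs_count I k i\<close> is the value of
  the counter \<open>K\<^sub>i\<close> at the beginning of round \<open>k\<close>.
\<close>

definition prs_count :: "(nat \<Rightarrow> nat) \<Rightarrow> nat \<Rightarrow> nat \<Rightarrow> nat" where
  "prs_count I k i = card {j. j < k \<and> I j = i}"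

text \<open>At \<open>i = 0\<close> the denominator below is \<open>1\<close>, because of the factor \<open>real i\<close>.\<close>

definition prs_weight :: "(nat \<Rightarrow> nat) \<Rightarrow> nat \<Rightarrow> real" where
  "prs_weight K i = (1 - 1 / 2 ^ (i + 2)) ^ K i / (1 + real i * (log 2 (real i))\<^sup>2)"

definition prs_step :: "(nat \<Rightarrow> nat) \<Rightarrow> nat pmf" where
  "prs_step K = embed_pmf (\<lambda>i. prs_weight K i / (\<Sum>j. prs_weight K j))"

lemma prs_weight_pos: "0 < prs_weight K i"
proof -
  have "(1::real) < 2 ^ (i + 2)"
    by (rule one_less_power) auto
  then have "(0::real) < 1 - 1 / 2 ^ (i + 2)"
    by simp
  moreover have "0 < 1 + real i * (log 2 (real i))\<^sup>2"
    by (intro add_pos_nonneg) auto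
  ultimately show ?thesis
    unfolding prs_weight_def by simp
qed

lemma summable_prs_weight: "summable (prs_weight K)"
proof -
  define g :: "nat \<Rightarrow> real" where "g i = 1 / (1 + real i * (log 2 (real i))\<^sup>2)" for i
  have g_nonneg: "0 \<le> g i" for i
    unfolding g_def by simp
  have g_decr: "g (Suc m) \<le> g m" if "0 < m" for m
  proof -
    have "log 2 (real m) \<le> log 2 (real (Suc m))" "0 \<le> log 2 (real m)"
      using that by auto
    then have "(log 2 (real m))\<^sup>2 \<le> (log 2 (real (Suc m)))\<^sup>2"
      by (intro power_mono)
    then have "real m * (log 2 (real m))\<^sup>2 \<le> real (Suc m) * (log 2 (real (Suc m)))\<^sup>2"
      by (intro mult_mono) auto
    moreover have "0 < 1 + real m * (log 2 (real m))\<^sup>2"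
      by (intro add_pos_nonneg) auto
    ultimately show ?thesis
      unfolding g_def by (intro divide_left_mono mult_pos_pos) auto
  qed
  have "summable (\<lambda>n. 2 ^ n * g (2 ^ n))"
  proof (rule summable_comparison_test')
    show "summable (\<lambda>n. inverse (real n ^ 2))"
      by (rule inverse_power_summable) auto
    fix n :: nat assume "1 \<le> n"
    have "2 ^ n * g (2 ^ n) = 2 ^ n / (1 + 2 ^ n * (real n)\<^sup>2)"
      by (simp add: g_def log_nat_power)
    also have "\<dots> \<le> 2 ^ n / (2 ^ n * (real n)\<^sup>2)"
      using \<open>1 \<le> n\<close> by (intro divide_left_mono mult_pos_pos add_pos_nonneg) auto
    also have "\<dots> = inverse ((real n)\<^sup>2)"
      by (simp add: field_simps)
    finally show "norm (2 ^ n * g (2 ^ n)) \<le> inverse (real n ^ 2)"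
      using g_nonneg by simp
  qed
  then have "summable g"
    using condensation_test[of g] g_decr g_nonneg by blast
  then show ?thesis
  proof (rule summable_comparison_test')
    fix i :: nat
    have "(1::real) \<le> 2 ^ (i + 2)"
      by (rule one_le_power) simp
    then have "(1 - 1 / 2 ^ (i + 2) :: real) ^ K i \<le> 1"
      by (intro power_le_one) auto
    then have "prs_weight K i \<le> g i"
      unfolding prs_weight_def g_def by (intro divide_right_mono) auto
    then show "norm (prs_weight K i) \<le> g i"
      using prs_weight_pos[of K i] by simp
  qed
qed

lemma pmf_prs_step: "pmf (prs_step K) i = prs_weight K i / (\<Sum>j. prs_weight K j)"
proof -
  have pos: "0 < (\<Sum>j. prs_weight K j)"
    by (intro suminf_pos summable_prs_weight prs_weight_pos)
  have "(\<integral>\<^sup>+ i. ennreal (prs_weight K i / (\<Sum>j. prs_weight K j)) \<partial>count_space UNIV)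
      = (\<Sum>i. ennreal (prs_weight K i / (\<Sum>j. prs_weight K j)))"
    by (rule nn_integral_count_space_nat)
  also have "\<dots> = ennreal (\<Sum>i. prs_weight K i / (\<Sum>j. prs_weight K j))"
    using pos prs_weight_pos[of K]
    by (intro suminf_ennreal2 summable_divide summable_prs_weight divide_nonneg_pos less_imp_le)
  also have "\<dots> = 1"
    using pos by (simp add: suminf_divide[OF summable_prs_weight])
  finally show ?thesis
    unfolding prs_step_def using pos prs_weight_pos[of K]
    by (intro pmf_embed_pmf divide_nonneg_pos less_imp_le)
qed

text \<open>Conditionally on the first \<open>k\<close> indices, the next one has distribution \<open>prs_step\<close>.\<close>

definition prs_kernel :: "nat \<Rightarrow> (nat \<Rightarrow> nat) \<Rightarrow> nat measure" where
  "prs_kernel k I = measure_pmf (prs_step (prs_count I k))"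

interpretation PRS: Ionescu_Tulcea prs_kernel "\<lambda>_. count_space UNIV"
proof (rule Ionescu_Tulcea.intro)
  fix k :: nat
  have "(\<Pi>\<^sub>M i\<in>{0..<k}. count_space (UNIV :: nat set)) = count_space ({0..<k} \<rightarrow>\<^sub>E UNIV)"
    by (rule count_space_PiM_finite) auto
  then show "prs_kernel k \<in> (\<Pi>\<^sub>M i\<in>{0..<k}. count_space UNIV) \<rightarrow>\<^sub>M subprob_algebra (count_space UNIV)"
    by (auto simp: prs_kernel_def space_subprob_algebra
             intro!: prob_space_imp_subprob_space measure_pmf.prob_space_axioms)
next
  fix k :: nat and I :: "nat \<Rightarrow> nat"
  show "prob_space (prs_kernel k I)"
    unfolding prs_kernel_def by (rule measure_pmf.prob_space_axioms)
qed

definition prs_space :: "(nat \<Rightarrow> nat) measure" where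
  "prs_space = PRS.PF.lim"

definition prs_cutoff :: "(nat \<Rightarrow> nat) \<Rightarrow> nat \<Rightarrow> real" where
  "prs_cutoff I k = 1 / (1 - 1 / 2 ^ (I k + 2)) ^ prs_count I k (I k)"

end

theory Submission
  imports Defs "HOL-Real_Asymp.Real_Asymp"
begin

text \<open>
  An index of PRS is drawn with probability inversely proportional to its next cutoff, so each index
  \<open>i\<close> receives, in expectation and whatever the past, a share of the time proportional to its base
  weight \<open>1 / (1 + i * (log 2 i)\<^sup>2)\<close>. Keeping only the runs of a single index \<open>i\<close>, whose cutoffs form a
  geometric sequence of ratio \<open>1 / (1 - 2 ^ - (i + 2))\<close>, gives an expected cost of order
  \<open>(1 + i * (log 2 i)\<^sup>2) * 2 ^ i * s\<close> as soon as a run of length \<open>s\<close> succeeds with probability at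
  least \<open>2 ^ - (i + 1)\<close>.

  The condition on \<open>\<phi>\<close> makes \<open>t powr g * \<phi>' t\<close> eventually increasing for some \<open>g < 2\<close>. Hence if \<open>m\<close>
  is the \<open>\<phi>\<close>-mean and \<open>M = 2 * m\<close>, the expectation of \<open>(M / T) powr (g - 1)\<close> on \<open>T \<le> M\<close> is bounded
  below, so some scale \<open>M / 2 ^ j\<close> has success probability at least of order \<open>2 powr (- b * j)\<close> with
  \<open>b < 1\<close>. Choosing \<open>i\<close> close to \<open>b * j\<close>, the factor \<open>2 powr ((b - 1) * j)\<close> absorbs the polynomial
  factor in \<open>i\<close>.
\<close>

section \<open>A bound on the expected cost\<close>

text \<open>Round \<open>k\<close> is reached exactly when all earlier rounds fail, and the final
  run costs at most its cutoff. Charging every round that is reached its full cutoff gives a series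
  of nonnegative terms, which also covers the case where no round succeeds.\<close>

lemma multistart_time_le:
  "multistart_time S t \<le> (\<Sum>k. ennreal (S k) * (if \<forall>l<k. ennreal (S l) < t l then 1 else 0))"
    (is "_ \<le> suminf ?f")
proof (cases "\<exists>k. t k \<le> ennreal (S k)")
  case True
  define K where "K = (LEAST k. t k \<le> ennreal (S k))"
  have K: "t K \<le> ennreal (S K)"
    unfolding K_def using True by (rule LeastI_ex)
  have less: "ennreal (S l) < t l" if "l < K" for l
    using not_less_Least[of l "\<lambda>k. t k \<le> ennreal (S k)"] that unfolding K_def by simp
  have "multistart_time S t = (\<Sum>k<K. ennreal (S k)) + t K"
    using True by (simp add: multistart_time_def K_def Let_def)
  also have "\<dots> \<le> (\<Sum>k<K. ennreal (S k)) + ennreal (S K)"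
    using K by (intro add_left_mono)
  also have "\<dots> = (\<Sum>k<Suc K. ?f k)"
    using less by simp
  also have "\<dots> \<le> suminf ?f"
    by (intro sum_le_suminf) auto
  finally show ?thesis .
next
  case False
  then have "multistart_time S t = (\<Sum>k. ennreal (S k))"
    unfolding multistart_time_def by (rule if_not_P)
  also have "\<dots> \<le> suminf ?f"
    using False by (simp add: not_le)
  finally show ?thesis .
qed

text \<open>Tonelli lets the running times be integrated first, for fixed cutoffs; by independence
  the event that the first \<open>k\<close> rounds fail then has a probability that is a product of
  tails of \<open>p\<close>.\<close>

lemma expected_cost_le:
  assumes p: "prob_space p" "sets p = sets borel"
    and S [measurable]: "\<And>k. (\<lambda>\<omega>. S \<omega> k) \<in> borel_measurable M"
  shows "expected_cost p M S \<le>
    (\<Sum>k. \<integral>\<^sup>+\<omega>. ennreal (S \<omega> k) * (\<Prod>l<k. emeasure p {t. ennreal (S \<omega> l) < t}) \<partial>M)"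
proof -
  interpret p: prob_space p by fact
  interpret P: product_prob_space "\<lambda>_. p" "UNIV :: nat set"
    by unfold_locales
  note [measurable_cong] = p(2)
  let ?P = "\<Pi>\<^sub>M k\<in>(UNIV::nat set). p"
  have space_p: "space p = UNIV"
    using sets_eq_imp_space_eq[OF p(2)] by simp
  have sets_p: "{t. ennreal s < t} \<in> sets p" for s
    unfolding p(2) by simp
  have meas: "(\<lambda>x. ennreal (S (fst x) k) * (if \<forall>l<k. ennreal (S (fst x) l) < snd x l then 1 else 0))
      \<in> borel_measurable (M \<Otimes>\<^sub>M ?P)" for k
    by measurable
  have "expected_cost p M S \<le>
    (\<integral>\<^sup>+x. (\<Sum>k. ennreal (S (fst x) k) * (if \<forall>l<k. ennreal (S (fst x) l) < snd x l then 1 else 0)) \<partial>(M \<Otimes>\<^sub>M ?P))"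
    unfolding expected_cost_def by (intro nn_integral_mono multistart_time_le)
  also have "\<dots> = (\<Sum>k. \<integral>\<^sup>+x. ennreal (S (fst x) k) * (if \<forall>l<k. ennreal (S (fst x) l) < snd x l then 1 else 0) \<partial>(M \<Otimes>\<^sub>M ?P))"
    by (intro nn_integral_suminf meas)
  also have "\<dots> = (\<Sum>k. \<integral>\<^sup>+\<omega>. \<integral>\<^sup>+t. ennreal (S \<omega> k) * (if \<forall>l<k. ennreal (S \<omega> l) < t l then 1 else 0) \<partial>?P \<partial>M)"
    by (subst P.nn_integral_fst[OF meas, symmetric]) simp
  also have "\<dots> = (\<Sum>k. \<integral>\<^sup>+\<omega>. ennreal (S \<omega> k) * (\<Prod>l<k. emeasure p {t. ennreal (S \<omega> l) < t}) \<partial>M)"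
  proof (intro suminf_cong nn_integral_cong)
    fix k \<omega> assume "\<omega> \<in> space M"
    let ?A = "{t\<in>space ?P. \<forall>l\<in>{..<k}. t l \<in> {t. ennreal (S \<omega> l) < t}}"
    have A: "?A \<in> sets ?P"
      by measurable
    have "(\<integral>\<^sup>+t. ennreal (S \<omega> k) * (if \<forall>l<k. ennreal (S \<omega> l) < t l then 1 else 0) \<partial>?P) =
       (\<integral>\<^sup>+t. ennreal (S \<omega> k) * indicator ?A t \<partial>?P)"
      by (intro nn_integral_cong) (auto split: split_indicator)
    also have "\<dots> = ennreal (S \<omega> k) * emeasure ?P ?A"
      using A by (rule nn_integral_cmult_indicator)
    also have "emeasure ?P ?A = (\<Prod>l<k. emeasure p {t. ennreal (S \<omega> l) < t})"
      by (rule P.emeasure_PiM_Collect) (auto simp: sets_p)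
    finally show "(\<integral>\<^sup>+t. ennreal (S \<omega> k) * (if \<forall>l<k. ennreal (S \<omega> l) < t l then 1 else 0) \<partial>?P) =
      ennreal (S \<omega> k) * (\<Prod>l<k. emeasure p {t. ennreal (S \<omega> l) < t})" .
  qed
  finally show ?thesis .
qed

section \<open>The law of finitely many PRS draws\<close>

lemma count_space_PiM_lessThan:
  "(\<Pi>\<^sub>M i\<in>{0..<k::nat}. count_space (UNIV :: nat set)) = count_space ({0..<k} \<rightarrow>\<^sub>E UNIV)"
  by (rule count_space_PiM_finite) auto

lemma sets_prs_space [measurable_cong]:
  "sets prs_space = sets (\<Pi>\<^sub>M i\<in>(UNIV::nat set). count_space (UNIV :: nat set))"
  unfolding prs_space_def by (rule PRS.PF.sets_lim)

text \<open>The marginal of the projective limit on an initial segment is the composition of the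
  first \<open>k\<close> kernels, started from the empty history
  \<open>\<lambda>_. undefined\<close>.\<close>

lemma distr_prs_space_restrict:
  "distr prs_space (\<Pi>\<^sub>M i\<in>{0..<k}. count_space UNIV) (\<lambda>I. restrict I {0..<k}) = PRS.C 0 k (\<lambda>_. undefined)"
proof -
  have "(\<lambda>_. undefined) \<in> space (\<Pi>\<^sub>M i\<in>{0..<0::nat}. count_space (UNIV :: nat set))"
    by (simp add: space_PiM)
  from PRS.sets_C[OF this, of k]
  have sets_C: "sets (PRS.C 0 k (\<lambda>_. undefined)) = sets (\<Pi>\<^sub>M i\<in>{0..<k}. count_space (UNIV :: nat set))"
    by simp
  have "distr prs_space (\<Pi>\<^sub>M i\<in>{0..<k}. count_space UNIV) (\<lambda>I. restrict I {0..<k}) = PRS.CI {0..<k}"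
    unfolding prs_space_def by (rule PRS.distr_lim) simp
  also have "\<dots> = PRS.C 0 k (\<lambda>_. undefined)"
  proof (rule measure_eqI)
    show sets_CI: "sets (PRS.CI {0..<k}) = sets (PRS.C 0 k (\<lambda>_. undefined))"
      by (simp add: PRS.CI_def sets_C)
    fix X assume X: "X \<in> sets (PRS.CI {0..<k})"
    then have "X \<in> sets (\<Pi>\<^sub>M i\<in>{0..<k}. count_space (UNIV :: nat set))"
      by (simp add: sets_C sets_CI)
    then show "emeasure (PRS.CI {0..<k}) X = emeasure (PRS.C 0 k (\<lambda>_. undefined)) X"
      using sets.sets_into_space[of X "\<Pi>\<^sub>M i\<in>{0..<k}. count_space (UNIV :: nat set)"]
      by (subst PRS.emeasure_CI) (auto simp: prod_emb_id space_PiM)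
  qed
  finally show ?thesis .
qed

text \<open>The total mass is read off from the marginal on zero coordinates.\<close>

lemma prob_space_prs_space: "prob_space prs_space"
proof -
  have "prob_space (PRS.C 0 0 (\<lambda>_. undefined))"
    by (rule PRS.prob_space_C) (simp add: space_PiM)
  then show ?thesis
    unfolding distr_prs_space_restrict[symmetric] by (rule prob_space_distrD[rotated]) measurable
qed

text \<open>A function of the first \<open>k\<close> draws does not see the restriction to these
  coordinates, and it is measurable because their countable product is discrete.\<close>

lemma nn_integral_prs_space:
  assumes f: "\<And>I J. (\<And>j. j < k \<Longrightarrow> I j = J j) \<Longrightarrow> f I = f J"
  shows "(\<integral>\<^sup>+I. f I \<partial>prs_space) = (\<integral>\<^sup>+I. f I \<partial>PRS.C 0 k (\<lambda>_. undefined))"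
proof -
  have "(\<integral>\<^sup>+I. f I \<partial>PRS.C 0 k (\<lambda>_. undefined)) = (\<integral>\<^sup>+I. f (restrict I {0..<k}) \<partial>prs_space)"
    unfolding distr_prs_space_restrict[symmetric]
    by (rule nn_integral_distr)
       (measurable, simp only: count_space_PiM_lessThan measurable_count_space_eq1, simp)
  also have "\<dots> = (\<integral>\<^sup>+I. f I \<partial>prs_space)"
    by (intro nn_integral_cong f) auto
  finally show ?thesis ..
qed

text \<open>This is conditioning on the first \<open>k\<close> draws: the last kernel is split off
  the composition, and draw \<open>k\<close> is integrated out under
  \<open>prs_step\<close>.\<close>

lemma nn_integral_prs_space_Suc:
  assumes f: "\<And>I J. (\<And>j. j \<le> k \<Longrightarrow> I j = J j) \<Longrightarrow> f I = f J"
  shows "(\<integral>\<^sup>+I. f I \<partial>prs_space) =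
    (\<integral>\<^sup>+I. \<integral>\<^sup>+x. f (I(k := x)) \<partial>prs_step (prs_count I k) \<partial>PRS.C 0 k (\<lambda>_. undefined))"
proof -
  have u: "(\<lambda>_. undefined) \<in> space (\<Pi>\<^sub>M i\<in>{0..<0::nat}. count_space (UNIV :: nat set))"
    by (simp add: space_PiM)
  have meas: "f \<in> borel_measurable (\<Pi>\<^sub>M i\<in>{0..<Suc k}. count_space (UNIV :: nat set))"
    by (simp only: count_space_PiM_lessThan measurable_count_space_eq1) auto
  have "(\<integral>\<^sup>+I. f I \<partial>prs_space) = (\<integral>\<^sup>+I. f I \<partial>PRS.C 0 (Suc k) (\<lambda>_. undefined))"
    by (rule nn_integral_prs_space) (auto intro: f)
  also have "\<dots> = (\<integral>\<^sup>+I. \<integral>\<^sup>+J. f J \<partial>PRS.eP k I \<partial>PRS.C 0 k (\<lambda>_. undefined))"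
    using PRS.sets_C[OF u, of k]
    by (simp, subst nn_integral_bind[OF meas])
       (auto intro!: PRS.measurable_eP simp: measurable_cong_sets[OF PRS.sets_C[OF u, of k] refl])
  also have "\<dots> = (\<integral>\<^sup>+I. \<integral>\<^sup>+x. f (I(k := x)) \<partial>prs_step (prs_count I k) \<partial>PRS.C 0 k (\<lambda>_. undefined))"
    using PRS.space_C[OF u, of k]
    by (intro nn_integral_cong) (simp add: PRS.nn_integral_eP meas prs_kernel_def)
  finally show ?thesis .
qed

section \<open>Reduction to a single index\<close>

text \<open>The weight of an index that has not been drawn yet.\<close>

definition prs_base :: "nat \<Rightarrow> real" where
  "prs_base i = 1 / (1 + real i * (log 2 (real i))\<^sup>2)"

lemma prs_base_pos: "0 < prs_base i"
proof -
  have "0 < 1 + real i * (log 2 (real i))\<^sup>2"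
    by (intro add_pos_nonneg) auto
  then show ?thesis
    by (simp add: prs_base_def)
qed

lemma summable_prs_base: "summable prs_base"
  using summable_prs_weight[of "\<lambda>_. 0"] unfolding prs_weight_def[abs_def] prs_base_def[abs_def] by simp

text \<open>The common ratio of the geometric cutoffs produced by successive draws of index
  \<open>i\<close>.\<close>

definition prs_ratio :: "nat \<Rightarrow> real" where
  "prs_ratio i = 1 / (1 - 1 / 2 ^ (i + 2))"

lemma prs_cutoff_eq: "prs_cutoff I k = prs_ratio (I k) ^ prs_count I k (I k)"
  by (simp add: prs_cutoff_def prs_ratio_def power_divide)

lemma half_power_bounds: "0 < 1 / (2::real) ^ (i + 2)" "1 / (2::real) ^ (i + 2) \<le> 1 / 4"
proof -
  have "(4::real) * 1 \<le> 4 * 2 ^ i"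
    by (intro mult_left_mono one_le_power) auto
  then show "1 / (2::real) ^ (i + 2) \<le> 1 / 4"
    by (simp add: field_simps)
qed simp

lemma prs_ratio_ge_1: "1 \<le> prs_ratio i"
  using half_power_bounds[of i] unfolding prs_ratio_def by (auto simp: le_divide_eq simp del: power_add power_Suc)

text \<open>The weight decays exactly as fast as the next cutoff grows, so their product forgets the
  counter. The balance between the indices rests on this cancellation.\<close>

lemma prs_weight_mult_ratio: "prs_weight K i * prs_ratio i ^ K i = prs_base i"
proof -
  have "1 - 1 / (2::real) ^ (i + 2) \<noteq> 0"
    using half_power_bounds[of i] by linarith
  then show ?thesis
    by (simp add: prs_weight_def prs_ratio_def prs_base_def power_divide)
qed

section \<open>Counters and cutoffs as functions of the past draws\<close>

lemma prs_count_cong: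
  assumes "\<And>j. j < k \<Longrightarrow> I j = J j"
  shows "prs_count I k = prs_count J k"
  using assms unfolding prs_count_def by (intro ext arg_cong[where f=card]) auto

lemma prs_count_0: "prs_count I 0 i = 0"
  by (simp add: prs_count_def)

lemma prs_count_Suc: "prs_count I (Suc k) i = prs_count I k i + (if I k = i then 1 else 0)"
proof -
  have "{j. j < Suc k \<and> I j = i} = (if I k = i then insert k {j. j < k \<and> I j = i} else {j. j < k \<and> I j = i})"
    by (auto simp: less_Suc_eq)
  then show ?thesis
    by (simp add: prs_count_def)
qed

lemma prs_cutoff_cong:
  assumes "\<And>j. j \<le> k \<Longrightarrow> I j = J j"
  shows "prs_cutoff I k = prs_cutoff J k"
  using assms prs_count_cong[of k I J] by (simp add: prs_cutoff_eq)

lemma measurable_prs_space_finite: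
  fixes f :: "(nat \<Rightarrow> nat) \<Rightarrow> 'a::topological_space"
  assumes f: "\<And>I J. (\<And>j. j < k \<Longrightarrow> I j = J j) \<Longrightarrow> f I = f J"
  shows "f \<in> borel_measurable prs_space"
proof -
  have "(\<lambda>I. restrict I {0..<k}) \<in> prs_space \<rightarrow>\<^sub>M (\<Pi>\<^sub>M i\<in>{0..<k}. count_space (UNIV :: nat set))"
    by measurable
  moreover have "f \<in> borel_measurable (\<Pi>\<^sub>M i\<in>{0..<k}. count_space (UNIV :: nat set))"
    unfolding count_space_PiM_lessThan by simp
  ultimately have "(\<lambda>I. f (restrict I {0..<k})) \<in> borel_measurable prs_space"
    by (rule measurable_compose)
  moreover have "f (restrict I {0..<k}) = f I" for I
    by (rule f) simp
  ultimately show ?thesis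
    by simp
qed

lemma measurable_prs_cutoff: "(\<lambda>I. prs_cutoff I k) \<in> borel_measurable prs_space"
  by (rule measurable_prs_space_finite[of "Suc k"]) (auto intro!: prs_cutoff_cong)

text \<open>Probability times next cutoff is \<open>prs_base j / Z\<close> for each index
  \<open>j\<close>; the past enters only through the normalising constant \<open>Z\<close>. The set
  \<open>A\<close> is kept general so that one index and all indices can be compared.\<close>

lemma nn_integral_prs_step_cutoff:
  fixes I :: "nat \<Rightarrow> nat" and k :: nat
  defines "Z \<equiv> \<Sum>j. prs_weight (prs_count I k) j"
  shows "(\<integral>\<^sup>+x. ennreal (prs_ratio x ^ prs_count I k x) * indicator A x \<partial>prs_step (prs_count I k))
    = (\<Sum>j. ennreal (prs_base j / Z) * indicator A j)"
proof -
  have Z: "0 < Z"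
    unfolding Z_def by (intro suminf_pos summable_prs_weight prs_weight_pos)
  have "ennreal (pmf (prs_step (prs_count I k)) j) * (ennreal (prs_ratio j ^ prs_count I k j) * indicator A j)
     = ennreal (prs_base j / Z) * indicator A j" for j
  proof -
    have "ennreal (pmf (prs_step (prs_count I k)) j) * ennreal (prs_ratio j ^ prs_count I k j)
      = ennreal (prs_weight (prs_count I k) j * prs_ratio j ^ prs_count I k j / Z)"
      using prs_ratio_ge_1[of j] by (subst ennreal_mult''[symmetric]) (simp_all add: pmf_prs_step Z_def)
    then show ?thesis
      by (simp only: prs_weight_mult_ratio mult.assoc[symmetric])
  qed
  then show ?thesis
    by (simp add: nn_integral_measure_pmf nn_integral_count_space_nat)
qed

text \<open>
  Index \<open>j\<close> is drawn with probability inversely proportional to its next cutoff, so every index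
  contributes to the expected next cutoff in proportion to its base weight, whatever the past.
\<close>

lemma nn_integral_prs_cutoff_index:
  fixes h :: "(nat \<Rightarrow> nat) \<Rightarrow> ennreal"
  assumes h: "\<And>I J. (\<And>j. j < k \<Longrightarrow> I j = J j) \<Longrightarrow> h I = h J"
  shows "(\<integral>\<^sup>+I. ennreal (prs_cutoff I k) * h I \<partial>prs_space) =
    ennreal (suminf prs_base / prs_base i) *
    (\<integral>\<^sup>+I. ennreal (prs_cutoff I k) * indicator {i} (I k) * h I \<partial>prs_space)"
proof -
  define Z where "Z I = (\<Sum>j. prs_weight (prs_count I k) j)" for I
  have Z: "0 < Z I" for I
    unfolding Z_def by (intro suminf_pos summable_prs_weight prs_weight_pos)
  \<comment> \<open>Draw \<open>k\<close> is integrated out given the past; the factor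
    \<open>h\<close> is constant for this integral because it depends on earlier draws only.\<close>
  have step: "(\<integral>\<^sup>+I. ennreal (prs_cutoff I k) * indicator A (I k) * h I \<partial>prs_space) =
     (\<integral>\<^sup>+I. (\<Sum>j. ennreal (prs_base j / Z I) * indicator A j) * h I \<partial>PRS.C 0 k (\<lambda>_. undefined))" for A
  proof -
    let ?f = "\<lambda>I. ennreal (prs_cutoff I k) * indicator A (I k) * h I"
    have cong: "?f I = ?f J" if "\<And>j. j \<le> k \<Longrightarrow> I j = J j" for I J
      using that h[of I J] prs_cutoff_cong[of k I J] by simp
    have "(\<integral>\<^sup>+I. ?f I \<partial>prs_space) =
      (\<integral>\<^sup>+I. \<integral>\<^sup>+x. ?f (I(k := x)) \<partial>prs_step (prs_count I k) \<partial>PRS.C 0 k (\<lambda>_. undefined))"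
      by (rule nn_integral_prs_space_Suc) (rule cong)
    also have "\<dots> = (\<integral>\<^sup>+I. (\<Sum>j. ennreal (prs_base j / Z I) * indicator A j) * h I \<partial>PRS.C 0 k (\<lambda>_. undefined))"
    proof (intro nn_integral_cong)
      fix I :: "nat \<Rightarrow> nat"
      have "?f (I(k := x)) = ennreal (prs_ratio x ^ prs_count I k x) * indicator A x * h I" for x
        using prs_count_cong[of k "I(k := x)" I] h[of "I(k := x)" I] by (simp add: prs_cutoff_eq)
      then have "(\<integral>\<^sup>+x. ?f (I(k := x)) \<partial>prs_step (prs_count I k)) =
         (\<integral>\<^sup>+x. ennreal (prs_ratio x ^ prs_count I k x) * indicator A x \<partial>prs_step (prs_count I k)) * h I"
        by (simp add: nn_integral_multc)
      then show "(\<integral>\<^sup>+x. ?f (I(k := x)) \<partial>prs_step (prs_count I k)) =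
         (\<Sum>j. ennreal (prs_base j / Z I) * indicator A j) * h I"
        by (simp add: nn_integral_prs_step_cutoff Z_def)
    qed
    finally show ?thesis .
  qed
  have meas: "g \<in> borel_measurable (PRS.C 0 k (\<lambda>_. undefined))" for g :: "(nat \<Rightarrow> nat) \<Rightarrow> ennreal"
  proof -
    have "(\<lambda>_. undefined) \<in> space (\<Pi>\<^sub>M i\<in>{0..<0::nat}. count_space (UNIV :: nat set))"
      by (simp add: space_PiM)
    from PRS.sets_C[OF this, of k]
    have eq: "sets (PRS.C 0 k (\<lambda>_. undefined)) = sets (count_space ({0..<k} \<rightarrow>\<^sub>E (UNIV :: nat set)))"
      by (simp add: count_space_PiM_lessThan)
    show ?thesis
      unfolding measurable_cong_sets[OF eq refl] by simp
  qed
  have single: "(\<Sum>j. ennreal (prs_base j / Z I) * indicator {i} j) = ennreal (prs_base i / Z I)" for I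
    by (subst suminf_finite[of "{i}"]) auto
  \<comment> \<open>The unknown \<open>Z I\<close> cancels between the sum over all indices and the
    term of index \<open>i\<close>. The remaining factor does not depend on \<open>I\<close> and can
    leave the integral.\<close>
  have all: "(\<Sum>j. ennreal (prs_base j / Z I) * indicator UNIV j) =
      ennreal (suminf prs_base / prs_base i) * ennreal (prs_base i / Z I)" for I
  proof -
    have "(\<Sum>j. ennreal (prs_base j / Z I) * indicator UNIV j) = ennreal (\<Sum>j. prs_base j / Z I)"
      using Z[of I] prs_base_pos
      by (simp, intro suminf_ennreal2) (auto intro!: summable_divide summable_prs_base simp: less_imp_le)
    also have "(\<Sum>j. prs_base j / Z I) = suminf prs_base / prs_base i * (prs_base i / Z I)"
      using prs_base_pos[of i] by (simp add: suminf_divide summable_prs_base)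
    finally show ?thesis
      using prs_base_pos[of i] Z[of I] by (subst ennreal_mult''[symmetric]) (auto simp: less_imp_le)
  qed
  have "(\<integral>\<^sup>+I. ennreal (prs_cutoff I k) * h I \<partial>prs_space) =
     (\<integral>\<^sup>+I. ennreal (suminf prs_base / prs_base i) * (ennreal (prs_base i / Z I) * h I) \<partial>PRS.C 0 k (\<lambda>_. undefined))"
    using step[of UNIV] unfolding all by (simp add: mult.assoc)
  also have "\<dots> = ennreal (suminf prs_base / prs_base i) *
     (\<integral>\<^sup>+I. ennreal (prs_base i / Z I) * h I \<partial>PRS.C 0 k (\<lambda>_. undefined))"
    by (intro nn_integral_cmult meas)
  also have "(\<integral>\<^sup>+I. ennreal (prs_base i / Z I) * h I \<partial>PRS.C 0 k (\<lambda>_. undefined)) =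
     (\<integral>\<^sup>+I. ennreal (prs_cutoff I k) * indicator {i} (I k) * h I \<partial>prs_space)"
    using step[of "{i}"] unfolding single by simp
  finally show ?thesis .
qed

section \<open>Keeping only the rounds of one index\<close>

lemma prod_prs_cutoff_le:
  fixes F :: "real \<Rightarrow> ennreal"
  assumes F: "\<And>s. F s \<le> 1"
  shows "(\<Prod>l<k. F (prs_cutoff I l)) \<le> (\<Prod>m<prs_count I k i. F (prs_ratio i ^ m))"
proof (induction k)
  case (Suc k)
  show ?case
  proof (cases "I k = i")
    case True
    with Suc show ?thesis
      by (auto simp: prs_count_Suc prs_cutoff_eq intro!: mult_right_mono)
  next
    case False
    have "(\<Prod>l<Suc k. F (prs_cutoff I l)) \<le> (\<Prod>m<prs_count I k i. F (prs_ratio i ^ m)) * 1"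
      unfolding prod.lessThan_Suc by (intro mult_mono Suc F) auto
    with False show ?thesis
      by (simp add: prs_count_Suc)
  qed
qed (simp add: prs_count_0)

text \<open>The rounds that draw \<open>i\<close> use the cutoffs \<open>prs_ratio i ^ n\<close> for
  \<open>n = 0, 1, ...\<close> in this order, and the failure factors of the other rounds are at
  most 1. If \<open>i\<close> is drawn only finitely often, the left side is bounded by a partial
  sum of the right side.\<close>

lemma suminf_prs_cutoff_index_le:
  fixes F :: "real \<Rightarrow> ennreal"
  assumes F: "\<And>s. F s \<le> 1"
  shows "(\<Sum>k. ennreal (prs_cutoff I k) * indicator {i} (I k) * (\<Prod>l<k. F (prs_cutoff I l)))
    \<le> (\<Sum>n. ennreal (prs_ratio i ^ n) * (\<Prod>m<n. F (prs_ratio i ^ m)))" (is "suminf ?f \<le> suminf ?g")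
proof -
  have "(\<Sum>k<n. ?f k) \<le> (\<Sum>m<prs_count I n i. ?g m)" for n
  proof (induction n)
    case (Suc n)
    show ?case
    proof (cases "I n = i")
      case True
      have "?f n \<le> ?g (prs_count I n i)"
        using True prod_prs_cutoff_le[of F I n i, OF F]
        by (auto simp: prs_cutoff_eq intro!: mult_left_mono)
      with Suc True show ?thesis
        by (simp add: prs_count_Suc add_mono)
    next
      case False
      with Suc show ?thesis
        by (simp add: prs_count_Suc)
    qed
  qed (simp add: prs_count_0)
  also have "(\<Sum>m<prs_count I n i. ?g m) \<le> suminf ?g" for n
    by (intro sum_le_suminf) auto
  finally show ?thesis
    by (intro suminf_le_const) auto
qed

lemma expected_cost_prs_le:
  assumes p: "prob_space p" "sets p = sets borel"
  shows "expected_cost p prs_space prs_cutoff \<le> ennreal (suminf prs_base / prs_base i) *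
    (\<Sum>n. ennreal (prs_ratio i ^ n) * (\<Prod>m<n. emeasure p {t. ennreal (prs_ratio i ^ m) < t}))"
proof -
  interpret p: prob_space p by fact
  interpret prs: prob_space prs_space by (rule prob_space_prs_space)
  define F where "F s = emeasure p {t. ennreal s < t}" for s :: real
  have F: "F s \<le> 1" for s
    unfolding F_def by (rule p.emeasure_le_1)
  let ?G = "\<Sum>n. ennreal (prs_ratio i ^ n) * (\<Prod>m<n. F (prs_ratio i ^ m))"
  let ?c = "ennreal (suminf prs_base / prs_base i)"
  have "expected_cost p prs_space prs_cutoff \<le>
     (\<Sum>k. \<integral>\<^sup>+I. ennreal (prs_cutoff I k) * (\<Prod>l<k. F (prs_cutoff I l)) \<partial>prs_space)"
    unfolding F_def by (intro expected_cost_le p measurable_prs_cutoff)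
  \<comment> \<open>Here \<open>h\<close> is the probability, given the cutoffs, that the first
    \<open>k\<close> rounds all fail; it depends on the first \<open>k\<close> draws only.\<close>
  also have "\<dots> = (\<Sum>k. ?c *
     (\<integral>\<^sup>+I. ennreal (prs_cutoff I k) * indicator {i} (I k) * (\<Prod>l<k. F (prs_cutoff I l)) \<partial>prs_space))"
  proof (intro suminf_cong nn_integral_prs_cutoff_index prod.cong refl arg_cong[where f=F] prs_cutoff_cong)
  qed auto
  also have "\<dots> = ?c *
     (\<Sum>k. \<integral>\<^sup>+I. ennreal (prs_cutoff I k) * indicator {i} (I k) * (\<Prod>l<k. F (prs_cutoff I l)) \<partial>prs_space)"
    by (rule ennreal_suminf_cmult)
  also have "(\<Sum>k. \<integral>\<^sup>+I. ennreal (prs_cutoff I k) * indicator {i} (I k) * (\<Prod>l<k. F (prs_cutoff I l)) \<partial>prs_space)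
     = (\<integral>\<^sup>+I. (\<Sum>k. ennreal (prs_cutoff I k) * indicator {i} (I k) * (\<Prod>l<k. F (prs_cutoff I l))) \<partial>prs_space)"
  proof (rule nn_integral_suminf[symmetric])
    fix k
    show "(\<lambda>I. ennreal (prs_cutoff I k) * indicator {i} (I k) * (\<Prod>l<k. F (prs_cutoff I l))) \<in> borel_measurable prs_space"
    proof (rule measurable_prs_space_finite)
      fix I J :: "nat \<Rightarrow> nat" assume "\<And>j. j < Suc k \<Longrightarrow> I j = J j"
      then have "I k = J k" "\<And>l. l \<le> k \<Longrightarrow> prs_cutoff I l = prs_cutoff J l"
        by (auto intro!: prs_cutoff_cong)
      then show "ennreal (prs_cutoff I k) * indicator {i} (I k) * (\<Prod>l<k. F (prs_cutoff I l)) =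
          ennreal (prs_cutoff J k) * indicator {i} (J k) * (\<Prod>l<k. F (prs_cutoff J l))"
        by (auto intro!: arg_cong2[where f="(*)"] prod.cong)
    qed
  qed
  also have "\<dots> \<le> (\<integral>\<^sup>+I. ?G \<partial>prs_space)"
    by (intro nn_integral_mono suminf_prs_cutoff_index_le F)
  also have "\<dots> = ?G"
    by (simp add: prs.emeasure_space_1)
  finally show ?thesis
    unfolding F_def by (simp add: mult_left_mono)
qed

section \<open>Geometric cutoffs\<close>

lemma sum_power_minus_le:
  fixes x :: real
  assumes "0 < x" "x \<le> 1"
  shows "(\<Sum>n<m. (1 - x) ^ n) \<le> 1 / x"
proof -
  have "(\<Sum>n<m. (1 - x) ^ n) = (1 - (1 - x) ^ m) / x"
    using assms by (subst sum_gp_strict) auto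
  also have "\<dots> \<le> 1 / x"
    using assms by (intro divide_right_mono) auto
  finally show ?thesis .
qed

text \<open>
  Below the threshold \<open>s\<close> the terms grow geometrically with ratio \<open>r = 1 / (1 - x)\<close>; beyond it they
  decrease at least with ratio \<open>1 - x\<close>, because \<open>r * (1 - 2 * x) \<le> 1 - x\<close>.
\<close>

lemma geometric_cutoffs_cost_le:
  fixes F :: "real \<Rightarrow> ennreal" and x s :: real
  assumes x: "0 < x" "x \<le> 1 / 4" and s: "1 \<le> s"
    and F: "\<And>u. F u \<le> 1" "\<And>u. s \<le> u \<Longrightarrow> F u \<le> ennreal (1 - 2 * x)"
  defines "r \<equiv> 1 / (1 - x)"
  shows "(\<Sum>n. ennreal (r ^ n) * (\<Prod>m<n. F (r ^ m))) \<le> ennreal (8 / 3 * s / x)"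
proof -
  let ?f = "\<lambda>n. ennreal (r ^ n) * (\<Prod>m<n. F (r ^ m))"
  have r: "1 < r" "r \<le> 4 / 3" "r * (1 - x) = 1"
    using x by (auto simp: r_def divide_le_eq)
  \<comment> \<open>This is \<open>1 - 2 * x \<le> (1 - x)^2\<close> divided by
    \<open>1 - x\<close>: failure outweighs the growth of the cutoffs.\<close>
  have rd: "r * (1 - 2 * x) \<le> 1 - x"
  proof -
    have "1 - 2 * x \<le> (1 - x) * (1 - x)"
      by (simp add: algebra_simps)
    then show ?thesis
      using x by (simp add: r_def divide_le_eq)
  qed
  have "\<exists>n. s \<le> r ^ n"
    using real_arch_pow[OF r(1), of s] by (auto intro: less_imp_le)
  define N where "N = (LEAST n. s \<le> r ^ n)"
  have N: "s \<le> r ^ N"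
    unfolding N_def using \<open>\<exists>n. s \<le> r ^ n\<close> by (rule LeastI_ex)
  \<comment> \<open>The first cutoff to reach \<open>s\<close> overshoots it by at most one factor
    \<open>r \<le> 4 / 3\<close>.\<close>
  have rN: "r ^ N \<le> 4 / 3 * s"
  proof (cases N)
    case 0
    with s show ?thesis by simp
  next
    case (Suc m)
    then have "r ^ m < s"
      using not_less_Least[of m "\<lambda>n. s \<le> r ^ n"] by (simp add: N_def not_le)
    then have "r ^ N \<le> r * s"
      using r Suc by simp
    also have "\<dots> \<le> 4 / 3 * s"
      using r s by (intro mult_right_mono) auto
    finally show ?thesis .
  qed
  \<comment> \<open>Read backwards from \<open>N\<close>, the cutoffs decay with ratio
    \<open>1 - x\<close>; the failure probabilities are bounded by 1.\<close>
  have before: "?f n \<le> ennreal (r ^ N * (1 - x) ^ (N - n))" if "n \<le> N" for n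
  proof -
    have "?f n \<le> ennreal (r ^ n) * 1"
      by (intro mult_left_mono prod_le_1) (auto simp: F)
    moreover have "r ^ N * (1 - x) ^ (N - n) = r ^ n * (r * (1 - x)) ^ (N - n)"
      using that by (simp add: power_mult_distrib mult.assoc[symmetric] flip: power_add)
    then have "r ^ n = r ^ N * (1 - x) ^ (N - n)"
      using r by simp
    ultimately show ?thesis
      by (simp only: mult_1_right)
  qed
  have after: "?f (N + j) \<le> ennreal (r ^ N * (1 - x) ^ j)" for j
  proof (induction j)
    case 0
    show ?case
      using before[of N] by simp
  next
    case (Suc j)
    have "s \<le> r ^ (N + j)"
      using r by (intro order_trans[OF N power_increasing]) auto
    then have "?f (N + Suc j) \<le> ?f (N + j) * (ennreal r * ennreal (1 - 2 * x))"
      using F(2)[of "r ^ (N + j)"] r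
      by (simp add: ennreal_mult mult_ac) (intro mult_left_mono mult_right_mono, auto)
    also have "\<dots> \<le> ennreal (r ^ N * (1 - x) ^ j) * ennreal (1 - x)"
      using Suc r rd x by (intro mult_mono) (auto simp flip: ennreal_mult intro!: ennreal_leI)
    also have "\<dots> = ennreal (r ^ N * (1 - x) ^ Suc j)"
      using r x by (simp add: mult_ac flip: ennreal_mult)
    finally show ?case .
  qed
  \<comment> \<open>Each side of \<open>N\<close> contributes at most \<open>r ^ N / x\<close>,
    which with \<open>r ^ N \<le> 4 / 3 * s\<close> gives the constant \<open>8 / 3\<close>.\<close>
  have "(\<Sum>n<N + k. ?f n) \<le> ennreal (8 / 3 * s / x)" for k
  proof -
    have "(\<Sum>n<N. ?f n) \<le> (\<Sum>n<N. ennreal (r ^ N * (1 - x) ^ (N - n)))"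
      by (intro sum_mono before) auto
    also have "\<dots> = ennreal (\<Sum>n<N. r ^ N * (1 - x) ^ (N - n))"
      using r x by (intro sum_ennreal) auto
    also have "(\<Sum>n<N. r ^ N * (1 - x) ^ (N - n)) = r ^ N * (\<Sum>n<N. (1 - x) ^ Suc n)"
      unfolding sum_distrib_left by (subst sum.nat_diff_reindex[symmetric]) (auto intro!: sum.cong simp: Suc_diff_Suc)
    also have "(\<Sum>n<N. (1 - x) ^ Suc n) \<le> (\<Sum>n<N. (1 - x) ^ n)"
      using x by (intro sum_mono power_decreasing) auto
    also have "\<dots> \<le> 1 / x"
      using x by (intro sum_power_minus_le) auto
    finally have 1: "(\<Sum>n<N. ?f n) \<le> ennreal (r ^ N * (1 / x))"
      using r by (simp add: mult_left_mono ennreal_leI)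
    have "(\<Sum>j<k. ?f (N + j)) \<le> (\<Sum>j<k. ennreal (r ^ N * (1 - x) ^ j))"
      by (intro sum_mono after)
    also have "\<dots> = ennreal (r ^ N * (\<Sum>j<k. (1 - x) ^ j))"
      using r x unfolding sum_distrib_left by (intro sum_ennreal) auto
    also have "\<dots> \<le> ennreal (r ^ N * (1 / x))"
      using r x by (intro ennreal_leI mult_left_mono sum_power_minus_le) auto
    finally have 2: "(\<Sum>j<k. ?f (N + j)) \<le> ennreal (r ^ N * (1 / x))" .
    have "(\<Sum>n<N + k. ?f n) = (\<Sum>n<N. ?f n) + (\<Sum>j<k. ?f (N + j))"
      by (induction k) (auto simp: add.assoc)
    also have "\<dots> \<le> ennreal (r ^ N * (1 / x)) + ennreal (r ^ N * (1 / x))"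
      by (intro add_mono 1 2)
    also have "\<dots> = ennreal (2 * r ^ N / x)"
      using r x by (subst ennreal_plus[symmetric]) auto
    also have "\<dots> \<le> ennreal (8 / 3 * s / x)"
      using rN x by (intro ennreal_leI divide_right_mono) auto
    finally show ?thesis .
  qed
  moreover have "(\<Sum>n<k. ?f n) \<le> (\<Sum>n<N + k. ?f n)" for k
    by (intro sum_mono2) auto
  ultimately show ?thesis
    by (intro suminf_le_const) (auto intro: order_trans)
qed

text \<open>With \<open>x = 1 / 2 ^ (i + 2)\<close> the assumed success probability is at least
  \<open>2 * x\<close>, as the geometric estimate requires. The constant is
  \<open>32 / 3 = 4 * 8 / 3\<close>, since \<open>1 / x = 4 * 2 ^ i\<close>.\<close>

lemma expected_cost_prs_le_success:
  assumes p: "prob_space p" "sets p = sets borel"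
    and s: "1 \<le> s" and q: "1 / 2 ^ (i + 1) \<le> measure p {t. t \<le> ennreal s}"
  shows "expected_cost p prs_space prs_cutoff \<le>
    ennreal (32 / 3 * suminf prs_base * (1 + real i * (log 2 (real i))\<^sup>2) * 2 ^ i * s)"
proof -
  interpret p: prob_space p by fact
  have space_p: "space p = UNIV"
    using sets_eq_imp_space_eq[OF p(2)] by simp
  define x where "x = 1 / (2::real) ^ (i + 2)"
  have x: "0 < x" "x \<le> 1 / 4"
    using half_power_bounds[of i] by (simp_all add: x_def)
  have W: "0 < suminf prs_base"
    by (intro suminf_pos summable_prs_base prs_base_pos)
  have F: "emeasure p {t. ennreal u < t} \<le> ennreal (1 - 2 * x)" if "s \<le> u" for u
  proof -
    have sets: "{t. t \<le> ennreal v} \<in> sets p" for v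
      unfolding p(2) by simp
    have "{t. ennreal u < t} = space p - {t. t \<le> ennreal u}"
      by (auto simp: space_p)
    then have "measure p {t. ennreal u < t} = 1 - measure p {t. t \<le> ennreal u}"
      using p.prob_compl[OF sets] by simp
    also have "\<dots> \<le> 1 - measure p {t. t \<le> ennreal s}"
      using that s by (intro diff_left_mono p.finite_measure_mono sets) (auto intro: order_trans ennreal_leI)
    also have "\<dots> \<le> 1 - 2 * x"
      using q by (simp add: x_def)
    finally show ?thesis
      by (simp add: p.emeasure_eq_measure ennreal_leI)
  qed
  have "prs_ratio i = 1 / (1 - x)"
    by (simp add: prs_ratio_def x_def)
  then have "expected_cost p prs_space prs_cutoff \<le> ennreal (suminf prs_base / prs_base i) *
      (\<Sum>n. ennreal ((1 / (1 - x)) ^ n) * (\<Prod>m<n. emeasure p {t. ennreal ((1 / (1 - x)) ^ m) < t}))"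
    using expected_cost_prs_le[OF p, of i] by simp
  also have "\<dots> \<le> ennreal (suminf prs_base / prs_base i) * ennreal (8 / 3 * s / x)"
    by (intro mult_left_mono geometric_cutoffs_cost_le x s F p.emeasure_le_1) auto
  also have "\<dots> = ennreal (suminf prs_base / prs_base i * (8 / 3 * s / x))"
    using W s x prs_base_pos[of i] by (intro ennreal_mult[symmetric]) auto
  also have "suminf prs_base / prs_base i * (8 / 3 * s / x) =
      32 / 3 * suminf prs_base * (1 + real i * (log 2 (real i))\<^sup>2) * 2 ^ i * s"
    by (simp add: prs_base_def x_def)
  finally show ?thesis .
qed

section \<open>Increments of the concave function\<close>

text \<open>For some \<open>g\<close> between 1 and 2, \<phi>' decays no faster than
  \<open>t powr (- g)\<close>, up to a constant. Integrating this from \<open>t\<close> to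
  \<open>M = 2 * m\<close> gives \<open>(M / t) powr (g - 1)\<close> times
  \<open>M * \<phi>' M\<close>, and concavity bounds the latter by twice the increment of \<phi> on
  \<open>[m, M]\<close>. Hence \<open>a = g - 1\<close>.\<close>

lemma increment_le_power:
  fixes \<phi> \<phi>' \<phi>'' :: "real \<Rightarrow> real"
  assumes concave: "concave_on {1..} \<phi>"
    and mono: "strict_mono_on {1..} \<phi>"
    and D1: "\<And>t. 1 \<le> t \<Longrightarrow> (\<phi> has_real_derivative \<phi>' t) (at t within {1..})"
    and D2: "\<And>t. 1 \<le> t \<Longrightarrow> (\<phi>' has_real_derivative \<phi>'' t) (at t within {1..})"
    and liminf: "Liminf at_top (\<lambda>t. ereal (t * \<phi>'' t / \<phi>' t)) > ereal (-2)"
  obtains a B :: real where "0 < a" "a < 1" "0 < B"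
    "\<And>m t. 1 \<le> m \<Longrightarrow> 1 \<le> t \<Longrightarrow> t \<le> 2 * m \<Longrightarrow>
      \<phi> (2 * m) - \<phi> t \<le> B * (\<phi> (2 * m) - \<phi> m) * (2 * m / t) powr a"
proof -
  have int: "x \<in> interior {1..}" if "1 < x" for x :: real
    using that by simp
  then have at: "at x within {1..} = at x" if "1 < x" for x :: real
    using that by (intro at_within_interior) auto
  have tangent: "\<phi> y - \<phi> x \<le> \<phi>' x * (y - x)" if "1 < x" "1 \<le> y" for x y
  proof -
    have "convex_on {1..} (\<lambda>t. - \<phi> t)"
      using concave by (simp add: concave_on_def)
    moreover have "((\<lambda>t. - \<phi> t) has_real_derivative - \<phi>' x) (at x within {1..})"
      using that by (intro DERIV_minus D1) simp
    ultimately have "- \<phi> y - - \<phi> x \<ge> - \<phi>' x * (y - x)"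
      using that int[of x] by (intro convex_on_imp_above_tangent[where f="\<lambda>t. - \<phi> t"]) auto
    then show ?thesis
      by simp
  qed
  have pos: "0 < \<phi>' x" if "1 < x" for x
    using tangent[of x "x + 1"] strict_mono_onD[OF mono, of x "x + 1"] that by simp
  have antimono: "\<phi>' y \<le> \<phi>' x" if "1 < x" "x \<le> y" for x y
  proof (cases "x = y")
    case False
    have "\<phi>' y * (y - x) \<le> \<phi>' x * (y - x)"
      using tangent[of x y] tangent[of y x] that by (simp add: algebra_simps)
    with False that show ?thesis
      by simp
  qed simp
  \<comment> \<open>The liminf may exceed -1; capping \<open>c\<close> there ensures that
    \<open>g - 1\<close> is positive.\<close>
  obtain c :: real where c: "- 2 < c" "c < - 1" "ereal c < Liminf at_top (\<lambda>t. ereal (t * \<phi>'' t / \<phi>' t))"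
  proof -
    have "ereal (- 2) < min (ereal (- 1)) (Liminf at_top (\<lambda>t. ereal (t * \<phi>'' t / \<phi>' t)))"
      using liminf by simp
    from ereal_dense2[OF this] obtain c :: real where
      "ereal (- 2) < ereal c" "ereal c < min (ereal (- 1)) (Liminf at_top (\<lambda>t. ereal (t * \<phi>'' t / \<phi>' t)))"
      by blast
    then show ?thesis
      by (intro that[of c]) simp_all
  qed
  have "eventually (\<lambda>t. ereal c < ereal (t * \<phi>'' t / \<phi>' t)) at_top"
    by (rule less_LiminfD) (rule c)
  then obtain u where u: "\<And>t. u \<le> t \<Longrightarrow> c < t * \<phi>'' t / \<phi>' t"
    by (auto simp: eventually_at_top_linorder)
  define v where "v = max 2 u"
  define g where "g = - c"
  have g: "1 < g" "g < 2"
    using c by (simp_all add: g_def)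
  \<comment> \<open>The derivative of \<open>x powr g * \<phi>' x\<close> is
    \<open>x powr (g - 1) * (g * \<phi>' x + x * \<phi>'' x)\<close>, nonnegative by the choice of
    \<open>g = - c\<close>.\<close>
  have growth: "s powr g * \<phi>' s \<le> t powr g * \<phi>' t" if "v \<le> s" "s \<le> t" for s t
  proof (rule DERIV_nonneg_imp_nondecreasing[OF \<open>s \<le> t\<close>])
    fix x assume "s \<le> x" "x \<le> t"
    then have x: "1 < x" "u \<le> x"
      using that by (auto simp: v_def)
    have "c * \<phi>' x < x * \<phi>'' x"
      using u[OF x(2)] pos[of x] x by (simp add: less_divide_eq)
    then have "0 \<le> g * \<phi>' x + x * \<phi>'' x"
      by (simp add: g_def)
    then have "0 \<le> x powr (g - 1) * (g * \<phi>' x + x * \<phi>'' x)"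
      by simp
    also have "\<dots> = g * x powr (g - 1) * \<phi>' x + \<phi>'' x * x powr g"
      using x by (simp add: algebra_simps powr_diff)
    finally have nn: "0 \<le> g * x powr (g - 1) * \<phi>' x + \<phi>'' x * x powr g" .
    have "((\<lambda>x. x powr g) has_real_derivative g * x powr (g - 1)) (at x)"
      using x by (intro has_real_derivative_powr) auto
    moreover have "(\<phi>' has_real_derivative \<phi>'' x) (at x)"
      using D2[of x] at[of x] x by simp
    ultimately have "((\<lambda>x. x powr g * \<phi>' x) has_real_derivative
        g * x powr (g - 1) * \<phi>' x + \<phi>'' x * x powr g) (at x)"
      by (rule DERIV_mult)
    with nn show "\<exists>y. ((\<lambda>x. x powr g * \<phi>' x) has_real_derivative y) (at x) \<and> 0 \<le> y"
      by blast
  qed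
  have v: "2 \<le> v"
    by (simp add: v_def)
  obtain w where w: "w \<in> {1..v}" "\<And>s. s \<in> {1..v} \<Longrightarrow> \<phi>' s \<le> \<phi>' w"
  proof -
    have "continuous_on {1..v} \<phi>'"
      by (intro DERIV_continuous_on[where D=\<phi>'']) (auto intro: DERIV_subset[OF D2])
    then show ?thesis
      using continuous_attains_sup[of "{1..v}" \<phi>'] v that by auto
  qed
  have w_pos: "0 < \<phi>' w"
    using w(2)[of v] pos[of v] v by simp
  \<comment> \<open>The two factors of \<open>D\<close> pay for the bounded range below
    \<open>v\<close>, where \<open>growth\<close> says nothing: the first compares values of \<phi>'
    there, the second compares powers. Both are at least 1.\<close>
  define D where "D = \<phi>' w / \<phi>' v * v powr g"
  have D: "1 \<le> D"
  proof -
    have "1 * 1 \<le> \<phi>' w / \<phi>' v * v powr g"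
      using v g pos[of v] w(2)[of v] by (intro mult_mono ge_one_powr_ge_zero) auto
    then show ?thesis
      by (simp add: D_def)
  qed
  \<comment> \<open>Beyond \<open>v\<close> this is \<open>growth\<close>; if
    \<open>s < v \<le> t\<close> the comparison passes through \<open>v\<close>; below
    \<open>v\<close> it uses the maximum at \<open>w\<close> and the monotonicity of
    \<phi>'.\<close>
  have deriv_le: "\<phi>' s \<le> D * \<phi>' t * (t / s) powr g" if "1 < s" "s \<le> t" for s t
  proof -
    have "s powr g * \<phi>' s \<le> D * (t powr g * \<phi>' t)"
    proof (cases "v \<le> s")
      case True
      have "0 \<le> t powr g * \<phi>' t"
        using pos[of t] that by simp
      then have "t powr g * \<phi>' t \<le> D * (t powr g * \<phi>' t)"
        using D by (simp add: mult_le_cancel_right1)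
      with growth[OF True that(2)] show ?thesis
        by linarith
    next
      case sv: False
      show ?thesis
      proof (cases "v \<le> t")
        case True
        have "s powr g * \<phi>' s \<le> v powr g * \<phi>' w"
          using sv that g pos[of s] w(2)[of s] by (intro mult_mono powr_mono2) auto
        also have "\<dots> = D * \<phi>' v"
          using v pos[of v] by (simp add: D_def)
        also have "\<dots> \<le> D * (v powr g * \<phi>' v)"
          using D v g pos[of v] by (intro mult_left_mono) (auto simp: mult_le_cancel_right1 intro: ge_one_powr_ge_zero)
        also have "\<dots> \<le> D * (t powr g * \<phi>' t)"
          using D growth[OF order_refl True] by (intro mult_left_mono) auto
        finally show ?thesis .
      next
        case False
        have "\<phi>' s \<le> \<phi>' w / \<phi>' v * \<phi>' v"
          using w(2)[of s] sv that pos[of v] v by simp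
        also have "\<dots> \<le> \<phi>' w / \<phi>' v * \<phi>' t"
          using antimono[of t v] False that w_pos pos[of v] v by (intro mult_left_mono) auto
        also have "\<phi>' w / \<phi>' v * \<phi>' t \<le> D * \<phi>' t"
        proof -
          have "\<phi>' w / \<phi>' v * 1 \<le> \<phi>' w / \<phi>' v * v powr g"
            using w_pos pos[of v] v g by (intro mult_left_mono ge_one_powr_ge_zero) auto
          then show ?thesis
            using pos[of t] that by (intro mult_right_mono) (auto simp: D_def)
        qed
        finally have "s powr g * \<phi>' s \<le> t powr g * (D * \<phi>' t)"
          using that g pos[of s] by (intro mult_mono powr_mono2) auto
        then show ?thesis
          by (simp add: mult_ac)
      qed
    qed
    then have "\<phi>' s \<le> D * (t powr g * \<phi>' t) / s powr g"
      using that by (simp add: field_simps)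
    then show ?thesis
      using that by (simp add: powr_divide mult_ac)
  qed
  define a where "a = g - 1"
  have a: "0 < a" "a < 1"
    using g by (simp_all add: a_def)
  have "\<phi> (2 * m) - \<phi> t \<le> 2 * D / a * (\<phi> (2 * m) - \<phi> m) * (2 * m / t) powr a"
    if m: "1 \<le> m" and t: "1 \<le> t" "t \<le> 2 * m" for m t
  proof -
    define M where "M = 2 * m"
    define K where "K = D * \<phi>' M * M powr g"
    have K: "0 \<le> K"
      using D pos[of M] m by (simp add: K_def M_def)
    \<comment> \<open>The first term of \<open>h\<close> is an antiderivative of
      \<open>K * x powr (- g)\<close>, which dominates \<phi>'. Monotonicity of \<open>h\<close> is
      thus the integrated bound; only derivatives in the open interval are used, so
      \<open>t = 1\<close> is allowed.\<close>
    define h where "h x = - K / a * x powr (- a) - \<phi> x" for x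
    have "h t \<le> h M"
    proof (rule DERIV_nonneg_imp_increasing_open[of t M h])
      show "t \<le> M" using t by (simp add: M_def)
    next
      fix x assume x: "t < x" "x < M"
      have "((\<lambda>x. x powr (- a)) has_real_derivative (- a) * x powr (- a - 1)) (at x)"
        using x t by (intro has_real_derivative_powr) auto
      moreover have "(\<phi> has_real_derivative \<phi>' x) (at x)"
        using D1[of x] at[of x] x t by simp
      ultimately have "(h has_real_derivative - K / a * (- a * x powr (- a - 1)) - \<phi>' x) (at x)"
        unfolding h_def[abs_def] by (intro DERIV_diff DERIV_cmult)
      moreover have "0 \<le> - K / a * (- a * x powr (- a - 1)) - \<phi>' x"
      proof -
        have "\<phi>' x \<le> D * \<phi>' M * (M / x) powr g"
          using deriv_le[of x M] x t by simp
        also have "\<dots> = K * x powr (- g)"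
          using x t by (simp add: K_def powr_divide powr_minus_divide)
        also have "\<dots> = - K / a * (- a * x powr (- a - 1))"
        proof -
          have "- a - 1 = - g"
            by (simp add: a_def)
          with a show ?thesis
            by simp
        qed
        finally show ?thesis by simp
      qed
      ultimately show "\<exists>y. (h has_real_derivative y) (at x) \<and> 0 \<le> y"
        by blast
    next
      have "continuous_on {t..M} \<phi>"
        using t by (intro DERIV_continuous_on[where D=\<phi>'])
          (auto intro: DERIV_subset[OF D1])
      then show "continuous_on {t..M} h"
        unfolding h_def[abs_def] using t by (intro continuous_intros) auto
    qed
    then have "\<phi> M - \<phi> t \<le> K / a * t powr (- a) - K / a * M powr (- a)"
      by (simp add: h_def)
    also have "\<dots> \<le> K / a * t powr (- a)"
      using K a by simp
    also have "\<dots> = D / a * (M * \<phi>' M) * (M / t) powr a"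
    proof -
      have "M powr g = M powr a * M"
        using m by (simp add: a_def M_def powr_diff)
      moreover have "(M / t) powr a = M powr a * t powr (- a)"
        using t m by (simp add: M_def powr_divide powr_minus_divide del: times_divide_eq_left)
      ultimately show ?thesis
        by (simp add: K_def)
    qed
    also have "\<dots> \<le> D / a * (2 * (\<phi> M - \<phi> m)) * (M / t) powr a"
    proof -
      \<comment> \<open>The tangent at \<open>M\<close>, evaluated at
        \<open>m = M / 2\<close>.\<close>
      have "M * \<phi>' M \<le> 2 * (\<phi> M - \<phi> m)"
        using tangent[of M m] m by (simp add: M_def algebra_simps)
      then show ?thesis
        using D a by (intro mult_right_mono mult_left_mono) auto
    qed
    finally show ?thesis
      by (simp add: M_def mult_ac)
  qed
  with a D show thesis
    by (intro that[of a "2 * D / a"]) auto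
qed

section \<open>A scale with large success probability\<close>

text \<open>A monotone function tends to its supremum in \<open>ennreal\<close>; this handles the
  value of the extended \<phi> at infinity.\<close>

lemma Lim_at_top_ge:
  fixes \<phi> :: "real \<Rightarrow> real"
  assumes mono: "mono_on {1..} \<phi>" and s: "1 \<le> s"
  shows "ennreal (\<phi> s) \<le> Lim at_top (\<lambda>s. ennreal (\<phi> s))"
proof -
  define L where "L = (SUP s\<in>{1..}. ennreal (\<phi> s))"
  have le: "ennreal (\<phi> s) \<le> L" if "1 \<le> s" for s
    unfolding L_def using that by (intro SUP_upper) simp
  have "((\<lambda>s. ennreal (\<phi> s)) \<longlongrightarrow> L) at_top"
  proof (rule order_tendstoI)
    fix x assume "x < L"
    then obtain u where u: "1 \<le> u" "x < ennreal (\<phi> u)"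
      unfolding L_def less_SUP_iff by auto
    have "x < ennreal (\<phi> s)" if "u \<le> s" for s
      using u that mono_onD[OF mono, of u s] by (auto intro: less_le_trans ennreal_leI)
    then show "eventually (\<lambda>s. x < ennreal (\<phi> s)) at_top"
      by (auto simp: eventually_at_top_linorder)
  next
    fix x assume "L < x"
    then have "ennreal (\<phi> s) < x" if "1 \<le> s" for s
      using le[OF that] by (rule order.strict_trans1[rotated])
    then show "eventually (\<lambda>s. ennreal (\<phi> s) < x) at_top"
      by (auto simp: eventually_at_top_linorder)
  qed
  then have "Lim at_top (\<lambda>s. ennreal (\<phi> s)) = L"
    by (rule tendsto_Lim[rotated]) simp
  with le[OF s] show ?thesis
    by simp
qed

text \<open>The single term with \<open>j\<close> the integer part of \<open>log 2 (M / u)\<close>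
  suffices, because \<open>2 ^ j \<le> M / u < 2 ^ (j + 1)\<close>.\<close>

lemma dyadic_powr_le:
  fixes a u M :: real
  assumes a: "0 < a" and u: "0 < u" "u \<le> M"
  shows "ennreal ((M / u) powr a) \<le> (\<Sum>j. ennreal (2 powr (a * (real j + 1)) * indicator {..M / 2 ^ j} u))"
    (is "_ \<le> suminf ?f")
proof -
  define j where "j = nat \<lfloor>log 2 (M / u)\<rfloor>"
  have 1: "1 \<le> M / u"
    using u by simp
  then have "real j = of_int \<lfloor>log 2 (M / u)\<rfloor>"
    by (simp add: j_def)
  then have j: "real j \<le> log 2 (M / u)" "log 2 (M / u) < real j + 1"
    by linarith+
  have "2 powr real j \<le> M / u"
    using j(1) 1 by (simp add: le_log_iff)
  then have "u \<le> M / 2 ^ j"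
    using u by (simp add: powr_realpow field_simps)
  moreover have "M / u \<le> 2 powr (real j + 1)"
    using j(2) 1 by (simp add: log_less_iff less_imp_le)
  then have "(M / u) powr a \<le> (2 powr (real j + 1)) powr a"
    using a 1 by (intro powr_mono2) auto
  then have "(M / u) powr a \<le> 2 powr (a * (real j + 1))"
    by (simp add: powr_powr mult.commute)
  ultimately have "ennreal ((M / u) powr a) \<le> ?f j"
    by (auto intro!: ennreal_leI)
  also have "\<dots> \<le> (\<Sum>i<Suc j. ?f i)"
    by (rule member_le_sum) auto
  also have "\<dots> \<le> suminf ?f"
    by (intro sum_le_suminf) auto
  finally show ?thesis .
qed

text \<open>Integrating the increment bound over \<open>T\<close> and splitting
  \<open>(M / T) powr a\<close> dyadically bounds \<open>\<phi> M - \<phi> m\<close> by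
  \<open>B * \<Delta>\<close> times a weighted sum of the success probabilities. If all of them were
  below the claimed bound, this sum would be at most \<open>1 / (2 * B)\<close>, and the increment
  \<Delta> at most half of itself.\<close>

lemma success_probability_at_dyadic_scale:
  fixes \<phi> :: "real \<Rightarrow> real" and a b B :: real
  assumes a: "0 < a" "a < b" and B: "0 < B"
    and nonneg: "\<And>t. 1 \<le> t \<Longrightarrow> 0 \<le> \<phi> t" and mono: "strict_mono_on {1..} \<phi>"
    and incr: "\<And>m t. 1 \<le> m \<Longrightarrow> 1 \<le> t \<Longrightarrow> t \<le> 2 * m \<Longrightarrow>
      \<phi> (2 * m) - \<phi> t \<le> B * (\<phi> (2 * m) - \<phi> m) * (2 * m / t) powr a"
    and p: "running_time_distribution p"
    and m: "1 \<le> m" "(\<integral>\<^sup>+ t. extend_infinity \<phi> t \<partial>p) = ennreal (\<phi> m)"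
  defines "\<kappa> \<equiv> (1 - 2 powr (a - b)) / (2 powr a * (2 * B))"
  shows "\<exists>j. \<kappa> * 2 powr (- b * real j) \<le> measure p {t. t \<le> ennreal (2 * m / 2 ^ j)}"
proof (rule ccontr)
  interpret p: prob_space p
    using p by (simp add: running_time_distribution_def)
  have sets_p [measurable_cong]: "sets p = sets borel"
    using p by (simp add: running_time_distribution_def)
  have space_p: "space p = UNIV"
    using sets_eq_imp_space_eq[OF sets_p] by simp
  have p1: "AE t in p. 1 \<le> t"
    using p by (simp add: running_time_distribution_def)
  define M where "M = 2 * m"
  define P where "P j = measure p {t. t \<le> ennreal (M / 2 ^ j)}" for j :: nat
  define \<Delta> where "\<Delta> = \<phi> M - \<phi> m"
  have \<Delta>: "0 < \<Delta>"
    using strict_mono_onD[OF mono, of m M] m by (simp add: \<Delta>_def M_def)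
  assume "\<not> ?thesis"
  then have P: "P j \<le> \<kappa> * 2 powr (- b * real j)" for j
    by (simp add: P_def M_def not_le less_imp_le)
  have mono': "mono_on {1..} \<phi>"
    using mono by (rule strict_mono_on_imp_mono_on)
  \<comment> \<open>A measurable version of \<open>extend_infinity \<phi>\<close>: nothing is known
    of \<phi> below 1, so the argument is clamped there. The two agree almost surely, since the
    running time is at least 1.\<close>
  define e where "e t = (if t = \<infinity> then Lim at_top (\<lambda>s. ennreal (\<phi> s)) else ennreal (\<phi> (max 1 (enn2real t))))" for t
  have "mono (\<lambda>s. \<phi> (max 1 s))"
    by (intro monoI mono_onD[OF mono']) auto
  then have [measurable]: "(\<lambda>s. \<phi> (max 1 s)) \<in> borel_measurable borel"
    by (rule borel_measurable_mono)
  have e_meas [measurable]: "e \<in> borel_measurable p"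
    unfolding e_def by measurable
  have e_eq: "e t = extend_infinity \<phi> t" if "1 \<le> t" for t
  proof (cases t)
    case (real s)
    with that have "1 \<le> s" by simp
    with real show ?thesis
      by (simp add: e_def extend_infinity_def max_absorb2)
  qed (simp add: e_def extend_infinity_def)
  let ?I = "\<lambda>t j. ennreal (2 powr (a * (real j + 1))) * indicator {t. t \<le> ennreal (M / 2 ^ j)} t"
  have pointwise: "ennreal (\<phi> M) \<le> e t + ennreal (B * \<Delta>) * (\<Sum>j. ?I t j)" if t1: "1 \<le> t" for t
  proof (cases t)
    case top
    have "ennreal (\<phi> M) \<le> e t"
      using Lim_at_top_ge[OF mono', of M] m top by (simp add: e_def M_def)
    then show ?thesis
      by (rule order_trans) simp
  next
    case (real s)
    then have s: "1 \<le> s"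
      using t1 by simp
    have et: "e t = ennreal (\<phi> s)"
      using real s by (simp add: e_def max_absorb2)
    show ?thesis
    proof (cases "s \<le> M")
      case True
      have "ennreal (\<phi> M) \<le> ennreal (\<phi> s + B * \<Delta> * (M / s) powr a)"
        using incr[of m s] m s True by (intro ennreal_leI) (simp add: M_def \<Delta>_def)
      also have "\<dots> = e t + ennreal (B * \<Delta>) * ennreal ((M / s) powr a)"
        using nonneg[OF s] B \<Delta> by (simp add: et ennreal_mult)
      also have "ennreal ((M / s) powr a) \<le> (\<Sum>j. ennreal (2 powr (a * (real j + 1)) * indicator {..M / 2 ^ j} s))"
        using a s True by (intro dyadic_powr_le) auto
      also have "\<dots> = (\<Sum>j. ?I t j)"
        using real m by (intro suminf_cong) (auto simp: M_def split: split_indicator)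
      finally show ?thesis
        by (simp add: add_left_mono mult_left_mono)
    next
      case False
      then have "\<phi> M \<le> \<phi> s"
        using m by (intro mono_onD[OF mono']) (auto simp: M_def)
      then have "ennreal (\<phi> M) \<le> e t"
        by (simp add: et ennreal_leI)
      then show ?thesis
        by (rule order_trans) simp
    qed
  qed
  have "ennreal (\<phi> M) = (\<integral>\<^sup>+t. ennreal (\<phi> M) \<partial>p)"
    by (simp add: p.emeasure_space_1)
  also have "\<dots> \<le> (\<integral>\<^sup>+t. e t + ennreal (B * \<Delta>) * (\<Sum>j. ?I t j) \<partial>p)"
    using p1 by (intro nn_integral_mono_AE) (auto intro: pointwise)
  also have "\<dots> = (\<integral>\<^sup>+t. e t \<partial>p) + ennreal (B * \<Delta>) * (\<Sum>j. \<integral>\<^sup>+t. ?I t j \<partial>p)"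
    by (simp add: nn_integral_add nn_integral_cmult nn_integral_suminf)
  also have "(\<integral>\<^sup>+t. e t \<partial>p) = ennreal (\<phi> m)"
    unfolding m(2)[symmetric] using p1 by (intro nn_integral_cong_AE) (auto simp: e_eq)
  also have "(\<Sum>j. \<integral>\<^sup>+t. ?I t j \<partial>p) \<le> ennreal (1 / (2 * B))"
  proof -
    \<comment> \<open>The ratio of the geometric series that is left; \<kappa> is normalised so that
      its sum is \<open>1 / (2 * B)\<close>.\<close>
    define x where "x = (2::real) powr (a - b)"
    have x: "0 < x" "x < 1"
      using a powr_less_mono[of "a - b" 0 "2::real"] by (auto simp: x_def)
    have "(\<integral>\<^sup>+t. ?I t j \<partial>p) \<le> ennreal (\<kappa> * 2 powr a * x ^ j)" for j
    proof -
      have "(\<integral>\<^sup>+t. ?I t j \<partial>p) = ennreal (2 powr (a * (real j + 1))) * emeasure p {t. t \<le> ennreal (M / 2 ^ j)}"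
        by (rule nn_integral_cmult_indicator) (simp add: sets_p)
      also have "\<dots> = ennreal (2 powr (a * (real j + 1)) * P j)"
        by (simp add: P_def p.emeasure_eq_measure ennreal_mult)
      also have "\<dots> \<le> ennreal (2 powr (a * (real j + 1)) * (\<kappa> * 2 powr (- b * real j)))"
        by (intro ennreal_leI mult_left_mono P) auto
      also have "2 powr (a * (real j + 1)) * (\<kappa> * 2 powr (- b * real j)) = \<kappa> * 2 powr a * x ^ j"
        by (simp add: x_def powr_powr powr_add[symmetric] algebra_simps flip: powr_realpow)
      finally show ?thesis .
    qed
    then have "(\<Sum>j. \<integral>\<^sup>+t. ?I t j \<partial>p) \<le> (\<Sum>j. ennreal (\<kappa> * 2 powr a * x ^ j))"
      by (intro suminf_le) auto
    also have "\<dots> = ennreal (\<kappa> * 2 powr a * (1 / (1 - x)))"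
    proof (rule suminf_ennreal_eq)
      show "0 \<le> \<kappa> * 2 powr a * x ^ j" for j
        using x B by (simp add: \<kappa>_def x_def)
      show "(\<lambda>j. \<kappa> * 2 powr a * x ^ j) sums (\<kappa> * 2 powr a * (1 / (1 - x)))"
        using x by (intro sums_mult geometric_sums) auto
    qed
    also have "\<kappa> * 2 powr a * (1 / (1 - x)) = 1 / (2 * B)"
      using x by (simp add: \<kappa>_def flip: x_def)
    finally show ?thesis .
  qed
  finally have "ennreal (\<phi> M) \<le> ennreal (\<phi> m) + ennreal (B * \<Delta>) * ennreal (1 / (2 * B))"
    by (simp add: add_left_mono mult_left_mono)
  also have "\<dots> = ennreal (\<phi> m + \<Delta> / 2)"
    using B \<Delta> nonneg[of m] m by (simp add: ennreal_mult[symmetric] ennreal_plus[symmetric] del: ennreal_plus)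
  finally have "\<phi> M \<le> \<phi> m + \<Delta> / 2"
    using \<Delta> nonneg[of m] m by (subst (asm) ennreal_le_iff) auto
  with \<Delta> show False
    by (simp add: \<Delta>_def field_simps)
qed

section \<open>The upper bound\<close>

text \<open>From \<open>i < 2 ^ i\<close>. A crude polynomial bound is enough, as it will be
  multiplied by an exponentially decaying factor.\<close>

lemma log_square_le_cube: "1 + real i * (log 2 (real i))\<^sup>2 \<le> 1 + real i ^ 3"
proof (cases "i = 0")
  case False
  have "log 2 (real i) \<le> log 2 (2 ^ i)"
    using False of_nat_less_two_power[of i, where 'a=real] by (subst log_le_cancel_iff) auto
  then have "(log 2 (real i))\<^sup>2 \<le> (real i)\<^sup>2"
    using False by (intro power_mono) (auto simp: log_nat_power)
  then have "real i * (log 2 (real i))\<^sup>2 \<le> real i * (real i)\<^sup>2"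
    by (intro mult_left_mono) auto
  then show ?thesis
    by (simp add: power2_eq_square power3_eq_cube mult.assoc)
qed simp

lemma bounded_cube_mult_exp:
  fixes b c :: real
  assumes "b < 1"
  obtains H where "0 < H" "\<And>j::nat. (1 + (real j + c) ^ 3) * 2 powr (b * real j) / 2 ^ j \<le> H"
proof -
  define e where "e = (1 - b) * ln 2"
  have "0 < e"
    using assms by (simp add: e_def)
  then have "(\<lambda>j. (1 + (real j + c) ^ 3) * exp (- (e * real j))) \<longlonglongrightarrow> 0"
    by real_asymp
  also have "(\<lambda>j. (1 + (real j + c) ^ 3) * exp (- (e * real j))) =
      (\<lambda>j. (1 + (real j + c) ^ 3) * 2 powr (b * real j) / 2 ^ j)"
    by (simp add: e_def powr_def exp_diff algebra_simps flip: powr_realpow)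
  finally have "(\<lambda>j. (1 + (real j + c) ^ 3) * 2 powr (b * real j) / 2 ^ j) \<longlonglongrightarrow> 0" .
  then have "Bseq (\<lambda>j. (1 + (real j + c) ^ 3) * 2 powr (b * real j) / 2 ^ j)"
    by (intro convergent_imp_Bseq convergentI)
  then obtain H where H: "0 < H" "\<And>j. norm ((1 + (real j + c) ^ 3) * 2 powr (b * real j) / 2 ^ j) \<le> H"
    by (auto simp: Bseq_def)
  show thesis
  proof (rule that[OF H(1)])
    show "(1 + (real j + c) ^ 3) * 2 powr (b * real j) / 2 ^ j \<le> H" for j :: nat
      using H(2)[of j] unfolding real_norm_def by (rule order_trans[OF abs_ge_self])
  qed
qed

theorem theorem5:
  fixes \<phi> \<phi>' \<phi>'' :: "real \<Rightarrow> real"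
  assumes "\<And>t. 1 \<le> t \<Longrightarrow> 0 \<le> \<phi> t"
    and "concave_on {1..} \<phi>"
    and "strict_mono_on {1..} \<phi>"
    and "\<And>t. 1 \<le> t \<Longrightarrow> (\<phi> has_real_derivative \<phi>' t) (at t within {1..})"
    and "\<And>t. 1 \<le> t \<Longrightarrow> (\<phi>' has_real_derivative \<phi>'' t) (at t within {1..})"
    and "Liminf at_top (\<lambda>t. ereal (t * \<phi>'' t / \<phi>' t)) > ereal (-2)"
  shows "\<exists>C::real. C > 0 \<and> (\<forall>p. running_time_distribution p \<longrightarrow>
           expected_cost p prs_space prs_cutoff \<le> ennreal C * phi_mean \<phi> p)"
proof -
  note nonneg = assms(1) and mono = assms(3)
  obtain a B :: real where a: "0 < a" "a < 1" and B: "0 < B"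
    and incr: "\<And>m t. 1 \<le> m \<Longrightarrow> 1 \<le> t \<Longrightarrow> t \<le> 2 * m \<Longrightarrow>
      \<phi> (2 * m) - \<phi> t \<le> B * (\<phi> (2 * m) - \<phi> m) * (2 * m / t) powr a"
    using increment_le_power[OF assms(2-6)] by blast
  \<comment> \<open>Any value strictly between \<open>a\<close> and 1 works: \<open>a < b\<close>
    makes the dyadic series converge, \<open>b < 1\<close> absorbs the polynomial factor.\<close>
  define b where "b = (1 + a) / 2"
  have b: "a < b" "b < 1" "0 < b"
    using a by (simp_all add: b_def)
  define \<kappa> where "\<kappa> = (1 - 2 powr (a - b)) / (2 powr a * (2 * B))"
  have \<kappa>: "0 < \<kappa>"
    using b B powr_less_mono[of "a - b" 0 "2::real"] by (simp add: \<kappa>_def)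
  \<comment> \<open>A shift of the index that absorbs \<kappa>, in the sense that
    \<open>2 powr (- c) \<le> \<kappa>\<close>.\<close>
  define c where "c = max 0 (log 2 (1 / \<kappa>))"
  have c: "0 \<le> c" "1 / \<kappa> \<le> 2 powr c"
  proof -
    have "1 / \<kappa> = 2 powr log 2 (1 / \<kappa>)"
      using \<kappa> by simp
    also have "\<dots> \<le> 2 powr c"
      by (intro powr_mono) (auto simp: c_def)
    finally show "1 / \<kappa> \<le> 2 powr c" .
  qed (simp add: c_def)
  obtain H where H: "0 < H" "\<And>j::nat. (1 + (real j + (c + 1)) ^ 3) * 2 powr (b * real j) / 2 ^ j \<le> H"
    using bounded_cube_mult_exp[OF b(2)] by blast
  define W where "W = suminf prs_base"
  have W: "0 < W"
    unfolding W_def by (intro suminf_pos summable_prs_base prs_base_pos)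
  define C where "C = 32 / 3 * W * (2 powr (c + 1) * H * 2)"
  have C: "0 < C"
    using W H by (simp add: C_def)
  have "expected_cost p prs_space prs_cutoff \<le> ennreal C * phi_mean \<phi> p"
    if p: "running_time_distribution p" for p
  proof (cases "(\<integral>\<^sup>+ t. extend_infinity \<phi> t \<partial>p) \<in> (\<lambda>t. ennreal (\<phi> t)) ` {1..}")
    case False
    then have "phi_mean \<phi> p = \<infinity>"
      by (simp add: phi_mean_def)
    then show ?thesis
      using C by (simp add: ennreal_mult_top)
  next
    case True
    then obtain m where m: "1 \<le> m" "(\<integral>\<^sup>+ t. extend_infinity \<phi> t \<partial>p) = ennreal (\<phi> m)"
      by auto
    \<comment> \<open>Nonnegativity prevents \<open>ennreal\<close> from identifying distinct values
      of \<phi>, so the inverse returns \<open>m\<close>.\<close>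
    have "inj_on (\<lambda>t. ennreal (\<phi> t)) {1..}"
      using strict_mono_on_imp_inj_on[OF mono] nonneg by (auto simp: inj_on_def)
    then have "the_inv_into {1..} (\<lambda>t. ennreal (\<phi> t)) (ennreal (\<phi> m)) = m"
      using the_inv_into_f_f[of "\<lambda>t. ennreal (\<phi> t)" "{1..}" m] m(1) by simp
    then have mean: "phi_mean \<phi> p = ennreal m"
      using True m(2) by (simp add: phi_mean_def)
    interpret p: prob_space p
      using p by (simp add: running_time_distribution_def)
    have sets_p: "sets p = sets borel"
      using p by (simp add: running_time_distribution_def)
    obtain j where j: "\<kappa> * 2 powr (- b * real j) \<le> measure p {t. t \<le> ennreal (2 * m / 2 ^ j)}"
      using success_probability_at_dyadic_scale[OF a(1) b(1) B nonneg mono incr p m]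
      unfolding \<kappa>_def by blast
    define s where "s = 2 * m / 2 ^ j"
    \<comment> \<open>A scale below 1 has success probability 0, whereas the one at \<open>j\<close>
      is positive.\<close>
    have s: "1 \<le> s"
    proof (rule ccontr)
      assume "\<not> 1 \<le> s"
      then have "AE t in p. t \<notin> {t. t \<le> ennreal s}"
        using p by (auto simp: running_time_distribution_def not_le elim!: eventually_mono
            intro: less_le_trans[of _ 1])
      then have "measure p {t. t \<le> ennreal s} = 0"
        by (subst p.prob_eq_0) (auto simp: sets_p)
      then show False
        using j \<kappa> by (simp add: s_def mult_le_0_iff)
    qed
    \<comment> \<open>Rounding up makes \<open>1 / 2 ^ i\<close> at most
      \<open>\<kappa> * 2 powr (- b * j)\<close>, at the price of one factor 2 in
      \<open>2 ^ i\<close>.\<close>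
    define i where "i = nat \<lceil>b * real j + c\<rceil>"
    have "0 \<le> b * real j + c"
      using b c by simp
    then have "real i = of_int \<lceil>b * real j + c\<rceil>"
      by (simp add: i_def)
    then have i: "b * real j + c \<le> real i" "real i \<le> b * real j + c + 1"
      by linarith+
    have "1 / 2 ^ (i + 1) \<le> 1 / (2::real) ^ i"
      by (simp add: field_simps)
    also have "\<dots> = 1 / 2 powr real i"
      by (simp add: powr_realpow)
    also have "\<dots> \<le> 1 / 2 powr (b * real j + c)"
      using i by (intro divide_left_mono powr_mono) auto
    also have "\<dots> = 2 powr (- b * real j) / 2 powr c"
      by (simp add: powr_add powr_minus_divide)
    also have "\<dots> \<le> 2 powr (- b * real j) / (1 / \<kappa>)"
      using c \<kappa> by (intro divide_left_mono) auto
    also have "\<dots> \<le> measure p {t. t \<le> ennreal s}"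
      using j by (simp add: s_def mult.commute)
    finally have q: "1 / 2 ^ (i + 1) \<le> measure p {t. t \<le> ennreal s}" .
    \<comment> \<open>In the polynomial factor \<open>b * j\<close> may be replaced by
      \<open>j\<close>; the exponential factor keeps \<open>b * j\<close>, which division by
      \<open>2 ^ j\<close> in \<open>s\<close> outweighs.\<close>
    have "real i \<le> real j + (c + 1)"
      using i(2) b mult_right_mono[of b 1 "real j"] by simp
    then have "1 + real i * (log 2 (real i))\<^sup>2 \<le> 1 + (real j + (c + 1)) ^ 3"
      by (intro order_trans[OF log_square_le_cube] add_left_mono power_mono) auto
    moreover have "2 ^ i \<le> 2 powr (b * real j + c + 1)"
      using i(2) by (simp add: powr_mono flip: powr_realpow)
    ultimately have "(1 + real i * (log 2 (real i))\<^sup>2) * 2 ^ i * s \<le>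
        (1 + (real j + (c + 1)) ^ 3) * 2 powr (b * real j + c + 1) * s"
      using s c by (intro mult_right_mono mult_mono) auto
    also have "\<dots> = 2 powr (c + 1) * ((1 + (real j + (c + 1)) ^ 3) * 2 powr (b * real j) / 2 ^ j) * 2 * m"
      by (simp add: s_def powr_add)
    also have "\<dots> \<le> 2 powr (c + 1) * H * 2 * m"
      using m H(2)[of j] by (intro mult_right_mono mult_left_mono) auto
    finally have "32 / 3 * W * ((1 + real i * (log 2 (real i))\<^sup>2) * 2 ^ i * s) \<le>
        32 / 3 * W * (2 powr (c + 1) * H * 2 * m)"
      using W by (intro mult_left_mono) auto
    then have le: "32 / 3 * W * (1 + real i * (log 2 (real i))\<^sup>2) * 2 ^ i * s \<le> C * m"
      by (simp add: C_def mult.assoc)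
    have "expected_cost p prs_space prs_cutoff \<le>
        ennreal (32 / 3 * W * (1 + real i * (log 2 (real i))\<^sup>2) * 2 ^ i * s)"
      unfolding W_def by (rule expected_cost_prs_le_success[OF p.prob_space_axioms sets_p s q])
    also have "\<dots> \<le> ennreal (C * m)"
      using le by (rule ennreal_leI)
    also have "\<dots> = ennreal C * phi_mean \<phi> p"
      using C m by (simp add: mean ennreal_mult)
    finally show ?thesis .
  qed
  with C show ?thesis
    by blast
qed

end
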